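(* Let $T$ be a tree with vertex set $\{1,\ldots,n\}$, edge set $\{e_1,\ldots,e_{n-1}\}$ and nonzero real edge weights $w_1,\ldots,w_{n-1}$. Let $q$ be a vertex of degree $2$ with neighbours $p$ and $r$, and let $e_i=\{p,q\}$, $e_j=\{q,r\}$. Then the squared distance matrix $\Delta$ of $T$ satisfies $$\det\Delta=(-1)^{n-1}2^{2n-5}(w_i+w_j)^2\prod_{s=1}^{n-1}w_s^2\prod_{k\neq q}\tau_k.$$
   Context: For vertices $a\neq b$, $d(a,b)$ is the sum of the weights of the edges on the unique $ab$-path, $d(a,a)=0$, and $\Delta$ is the $n\times n$ matrix with $(a,b)$-entry $d(a,b)^2$. $\tau_k=2-\delta_k$ where $\delta_k$ is the degree of vertex $k$; the product $\prod_{k\neq q}$ runs over all vertices $k\in\{1,\ldots,n\}$ other than $q$. *)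

theory Defs
  imports "Jordan_Normal_Form.Determinant"
begin

text \<open>
  Undirected simple graphs are given by a vertex set and a set of two-element subsets of it.
  (The notion \<open>tree\<close> of the AFP entry Graph_Theory is not usable here: a symmetric digraph with
  at least one edge always contains a directed cycle of length two, so it is never a forest.)
\<close>

definition simple_graph :: "'v set \<Rightarrow> 'v set set \<Rightarrow> bool" where
  "simple_graph V E \<longleftrightarrow> finite V \<and> (\<forall>f\<in>E. f \<subseteq> V \<and> card f = 2)"

definition path_edges :: "'v list \<Rightarrow> 'v set set" where
  "path_edges xs = {{xs ! m, xs ! Suc m} | m. Suc m < length xs}"

text \<open>The one-vertex list \<open>[a]\<close> is the (only) path from \<open>a\<close> to \<open>a\<close>.\<close>

definition is_path :: "'v set set \<Rightarrow> 'v \<Rightarrow> 'v \<Rightarrow> 'v list \<Rightarrow> bool" where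
  "is_path E a b xs \<longleftrightarrow>
     xs \<noteq> [] \<and> hd xs = a \<and> last xs = b \<and> distinct xs \<and> path_edges xs \<subseteq> E"

definition is_cycle :: "'v set set \<Rightarrow> 'v list \<Rightarrow> bool" where
  "is_cycle E xs \<longleftrightarrow>
     length xs \<ge> 3 \<and> distinct xs \<and> path_edges xs \<subseteq> E \<and> {last xs, hd xs} \<in> E"

definition is_tree :: "'v set \<Rightarrow> 'v set set \<Rightarrow> bool" where
  "is_tree V E \<longleftrightarrow>
     simple_graph V E \<and> V \<noteq> {} \<and>
     (\<forall>a\<in>V. \<forall>b\<in>V. \<exists>xs. is_path E a b xs) \<and>
     (\<nexists>xs. is_cycle E xs)"

definition neighbours :: "'v set set \<Rightarrow> 'v \<Rightarrow> 'v set" where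
  "neighbours E v = {u. {u, v} \<in> E}"

definition vdegree :: "'v set set \<Rightarrow> 'v \<Rightarrow> nat" where
  "vdegree E v = card (neighbours E v)"

definition tau :: "'v set set \<Rightarrow> 'v \<Rightarrow> int" where
  "tau E v = 2 - int (vdegree E v)"

definition the_path :: "'v set set \<Rightarrow> 'v \<Rightarrow> 'v \<Rightarrow> 'v list" where
  "the_path E a b = (THE xs. is_path E a b xs)"

text \<open>
  The edges are enumerated injectively as \<open>e s\<close> for \<open>s \<in> S\<close>, and \<open>w s\<close> is the weight of \<open>e s\<close>.
  For \<open>a = b\<close> the sum is empty, so that the distance is \<open>0\<close>.
\<close>

definition tree_dist ::
  "nat set \<Rightarrow> (nat \<Rightarrow> 'v set) \<Rightarrow> (nat \<Rightarrow> real) \<Rightarrow> 'v \<Rightarrow> 'v \<Rightarrow> real" where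
  "tree_dist S e w a b = (\<Sum>s | s \<in> S \<and> e s \<in> path_edges (the_path (e ` S) a b). w s)"

text \<open>
  Vertices are numbered \<open>1, \<dots>, n\<close> while matrix indices start at \<open>0\<close>; hence the shift by one.
\<close>

definition sq_dist_mat :: "nat \<Rightarrow> (nat \<Rightarrow> nat set) \<Rightarrow> (nat \<Rightarrow> real) \<Rightarrow> real mat" where
  "sq_dist_mat n e w = mat n n (\<lambda>(a, b). (tree_dist {1..n - 1} e w (Suc a) (Suc b))\<^sup>2)"

end

theory Submission
  imports Defs
begin

text \<open>
  Root the tree at \<open>q\<close>. Twice differencing the rows and columns of \<open>\<Delta>\<close> from child to parent, with
  the edge weights scaled out in between, turns \<open>\<Delta>\<close> into a matrix in which non-root vertices
  interact only if they are siblings. The block of the two children of \<open>q\<close> is singular, so that the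
  border row and column at \<open>q\<close> contribute exactly \<open>(w\<^sub>i + w\<^sub>j)\<^sup>2\<close>; a block of \<open>m\<close> siblings with
  parent \<open>v \<noteq> q\<close> is a multiple of \<open>I - J\<close>, whose determinant is \<open>1 - m = \<tau>\<^sub>v\<close>.
\<close>

text \<open>Keeps the lower bound of \<open>{1..n}\<close> as \<open>1\<close>; otherwise the
  simplifier would rewrite it to \<open>Suc 0\<close>.\<close>

declare One_nat_def [simp del]

section \<open>Determinants of matrices indexed by \<open>1, \<dots>, n\<close>\<close>

text \<open>Hides the shift between vertex numbers and matrix positions, so that entries can be
  written as functions of two vertices.\<close>

definition vmat :: "nat \<Rightarrow> (nat \<Rightarrow> nat \<Rightarrow> 'a) \<Rightarrow> 'a mat" where
  "vmat n F = mat n n (\<lambda>(a, b). F (Suc a) (Suc b))"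

lemma vmat_carrier [simp]: "vmat n F \<in> carrier_mat n n"
  by (simp add: vmat_def)

lemma vmat_cong:
  assumes "\<And>x y. x \<in> {1..n} \<Longrightarrow> y \<in> {1..n} \<Longrightarrow> F x y = G x y"
  shows "vmat n F = vmat n G"
  unfolding vmat_def by (rule cong_mat) (auto intro: assms)

lemma vmat_mult:
  fixes F G :: "nat \<Rightarrow> nat \<Rightarrow> 'a :: comm_ring_1"
  shows "vmat n F * vmat n G = vmat n (\<lambda>x y. \<Sum>z\<in>{1..n}. F x z * G z y)"
proof (rule eq_matI)
  fix i j assume "i < dim_row (vmat n (\<lambda>x y. \<Sum>z\<in>{1..n}. F x z * G z y))"
    and "j < dim_col (vmat n (\<lambda>x y. \<Sum>z\<in>{1..n}. F x z * G z y))"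
  then have ij: "i < n" "j < n" by (auto simp: vmat_def)
  have "(\<Sum>z\<in>{1..n}. F (Suc i) z * G z (Suc j)) = (\<Sum>k\<in>{0..<n}. F (Suc i) (Suc k) * G (Suc k) (Suc j))"
    by (rule sum.reindex_cong[of Suc]) (auto simp: image_Suc_atLeastLessThan atLeastLessThanSuc_atLeastAtMost)
  then show "(vmat n F * vmat n G) $$ (i, j) = vmat n (\<lambda>x y. \<Sum>z\<in>{1..n}. F x z * G z y) $$ (i, j)"
    using ij by (simp add: vmat_def scalar_prod_def)
qed (auto simp: vmat_def)

lemma det_vmat_mult:
  fixes F G :: "nat \<Rightarrow> nat \<Rightarrow> 'a :: comm_ring_1"
  shows "det (vmat n (\<lambda>x y. \<Sum>z\<in>{1..n}. F x z * G z y)) = det (vmat n F) * det (vmat n G)"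
  unfolding vmat_mult[symmetric] by (rule det_mult[OF vmat_carrier vmat_carrier])

lemma det_vmat_transpose:
  fixes F :: "nat \<Rightarrow> nat \<Rightarrow> 'a :: comm_ring_1"
  shows "det (vmat n (\<lambda>x y. F y x)) = det (vmat n F)"
proof -
  have "vmat n (\<lambda>x y. F y x) = transpose_mat (vmat n F)"
    by (rule eq_matI) (auto simp: vmat_def)
  then show ?thesis using det_transpose[of "vmat n F" n] by simp
qed

text \<open>A permutation whose steps \<open>x \<mapsto> \<pi> x\<close> never raise the rank preserves it, so only the
  identity contributes to the Leibniz sum.\<close>

lemma det_vmat_triangular:
  fixes F :: "nat \<Rightarrow> nat \<Rightarrow> 'a :: comm_ring_1" and rk :: "nat \<Rightarrow> nat"
  assumes tri: "\<And>x y. x \<in> {1..n} \<Longrightarrow> y \<in> {1..n} \<Longrightarrow> F x y \<noteq> 0 \<Longrightarrow> x = y \<or> rk y < rk x"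
  shows "det (vmat n F) = (\<Prod>x\<in>{1..n}. F x x)"
proof -
  let ?t = "\<lambda>\<pi>. signof \<pi> * (\<Prod>i = 0..<n. vmat n F $$ (i, \<pi> i))"
  have zero: "?t \<pi> = 0" if \<pi>: "\<pi> permutes {0..<n}" and "\<pi> \<noteq> id" for \<pi>
  proof (rule ccontr)
    assume nz: "?t \<pi> \<noteq> 0"
    have nz': "vmat n F $$ (i, \<pi> i) \<noteq> 0" if "i < n" for i
    proof
      assume "vmat n F $$ (i, \<pi> i) = 0"
      then have "(\<Prod>i = 0..<n. vmat n F $$ (i, \<pi> i)) = 0"
        using that by (intro prod_zero) auto
      then show False using nz by simp
    qed
    have step: "\<pi> i = i \<or> rk (Suc (\<pi> i)) < rk (Suc i)" if i: "i < n" for i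
    proof -
      have "\<pi> i < n" using permutes_in_image[OF \<pi>, of i] i by simp
      then show ?thesis using nz'[OF i] tri[of "Suc i" "Suc (\<pi> i)"] i by (auto simp: vmat_def)
    qed
    obtain k where k: "\<pi> k \<noteq> k" using \<open>\<pi> \<noteq> id\<close> by (metis eq_id_iff)
    then have "k < n" using permutes_not_in[OF \<pi>, of k] by auto
    have "(\<Sum>i\<in>{0..<n}. rk (Suc (\<pi> i))) < (\<Sum>i\<in>{0..<n}. rk (Suc i))"
    proof (rule sum_strict_mono_ex1)
      show "\<forall>i\<in>{0..<n}. rk (Suc (\<pi> i)) \<le> rk (Suc i)" using step by force
      show "\<exists>i\<in>{0..<n}. rk (Suc (\<pi> i)) < rk (Suc i)" using step[OF \<open>k < n\<close>] k \<open>k < n\<close> by auto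
    qed simp
    moreover have "(\<Sum>i\<in>{0..<n}. rk (Suc (\<pi> i))) = (\<Sum>i\<in>{0..<n}. rk (Suc i))"
      using sum.permute[OF \<pi>, of "\<lambda>i. rk (Suc i)"] by (simp add: comp_def)
    ultimately show False by simp
  qed
  have "det (vmat n F) = (\<Sum>\<pi> | \<pi> permutes {0..<n}. ?t \<pi>)"
    by (rule det_def') simp
  also have "\<dots> = (\<Sum>\<pi>\<in>{id}. ?t \<pi>)"
    by (rule sum.mono_neutral_right) (auto simp: permutes_id zero finite_permutations)
  also have "\<dots> = (\<Prod>i = 0..<n. F (Suc i) (Suc i))"
    by (simp add: vmat_def)
  also have "\<dots> = (\<Prod>x\<in>{1..n}. F x x)"
    by (rule prod.reindex_cong[of Suc, symmetric])
       (auto simp: image_Suc_atLeastLessThan atLeastLessThanSuc_atLeastAtMost)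
  finally show ?thesis .
qed

lemma det_vmat_scale_rows:
  fixes F :: "nat \<Rightarrow> nat \<Rightarrow> 'a :: comm_ring_1"
  shows "det (vmat n (\<lambda>x y. c x * F x y)) = (\<Prod>x\<in>{1..n}. c x) * det (vmat n F)"
proof -
  let ?D = "\<lambda>x y. if x = y then c x else 0"
  have "vmat n (\<lambda>x y. c x * F x y) = vmat n (\<lambda>x y. \<Sum>z\<in>{1..n}. ?D x z * F z y)"
    by (rule vmat_cong) (simp add: if_distrib[of "\<lambda>c. c * _"] cong: if_cong)
  moreover have "det (vmat n ?D) = (\<Prod>x\<in>{1..n}. c x)"
    by (subst det_vmat_triangular[of n ?D "\<lambda>_. 0"]) (auto split: if_splits)
  ultimately show ?thesis by (simp add: det_vmat_mult)
qed

lemma det_vmat_scale_both: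
  fixes F :: "nat \<Rightarrow> nat \<Rightarrow> 'a :: comm_ring_1"
  shows "det (vmat n (\<lambda>x y. c x * c y * F x y)) = (\<Prod>x\<in>{1..n}. c x)\<^sup>2 * det (vmat n F)"
proof -
  have "det (vmat n (\<lambda>x y. c x * c y * F x y)) = (\<Prod>x\<in>{1..n}. c x) * det (vmat n (\<lambda>x y. c y * F x y))"
    using det_vmat_scale_rows[of n c "\<lambda>x y. c y * F x y"] by (simp add: mult.assoc)
  also have "det (vmat n (\<lambda>x y. c y * F x y)) = (\<Prod>x\<in>{1..n}. c x) * det (vmat n F)"
    using det_vmat_transpose[of n "\<lambda>x y. c x * F y x"] det_vmat_scale_rows[of n c "\<lambda>x y. F y x"]
      det_vmat_transpose[of n F] by simp
  finally show ?thesis by (simp add: power2_eq_square)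
qed

text \<open>The change is a left multiplication by the identity plus \<open>c\<close> times the 0/1
  matrix of \<open>g\<close>. This factor is unitriangular because \<open>g\<close> lowers
  \<open>rk\<close>, so all rows may change at once, each by an original row.\<close>

lemma det_vmat_add_rows:
  fixes F :: "nat \<Rightarrow> nat \<Rightarrow> 'a :: comm_ring_1" and rk :: "nat \<Rightarrow> nat"
  assumes g: "\<And>x. x \<in> {1..n} \<Longrightarrow> P x \<Longrightarrow> g x \<in> {1..n} \<and> rk (g x) < rk x"
  shows "det (vmat n (\<lambda>x y. F x y + (if P x then c * F (g x) y else 0))) = det (vmat n F)"
proof -
  let ?N = "\<lambda>x y. (if x = y then 1 else 0) + (if P x \<and> g x = y then c else 0)"
  have "vmat n (\<lambda>x y. F x y + (if P x then c * F (g x) y else 0))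
      = vmat n (\<lambda>x y. \<Sum>z\<in>{1..n}. ?N x z * F z y)"
  proof (rule vmat_cong)
    fix x y assume x: "x \<in> {1..n}"
    have "(\<Sum>z\<in>{1..n}. ?N x z * F z y)
        = (\<Sum>z\<in>{1..n}. if x = z then F z y else 0) + (\<Sum>z\<in>{1..n}. if P x \<and> g x = z then c * F z y else 0)"
      by (subst sum.distrib[symmetric], rule sum.cong) (auto simp: algebra_simps)
    also have "(\<Sum>z\<in>{1..n}. if P x \<and> g x = z then c * F z y else 0) = (if P x then c * F (g x) y else 0)"
      using g[OF x] by auto
    finally show "F x y + (if P x then c * F (g x) y else 0) = (\<Sum>z\<in>{1..n}. ?N x z * F z y)"
      using x by simp
  qed
  moreover have "det (vmat n ?N) = (\<Prod>x\<in>{1..n}. ?N x x)"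
    by (rule det_vmat_triangular[of n ?N rk]) (use g in \<open>auto split: if_splits\<close>)
  moreover have "(\<Prod>x\<in>{1..n}. ?N x x) = 1"
    by (rule prod.neutral) (use g in force)
  ultimately show ?thesis by (simp add: det_vmat_mult)
qed

text \<open>The row operation is followed by the same column operation, through transposition.
  \<open>G\<close> is tied to \<open>F\<close> only entrywise, so that an application amounts to
  comparing entries.\<close>

lemma det_vmat_add_rows_cols:
  fixes F :: "nat \<Rightarrow> nat \<Rightarrow> 'a :: comm_ring_1" and rk :: "nat \<Rightarrow> nat"
  assumes g: "\<And>x. x \<in> {1..n} \<Longrightarrow> P x \<Longrightarrow> g x \<in> {1..n} \<and> rk (g x) < rk x"
    and G: "\<And>x y. x \<in> {1..n} \<Longrightarrow> y \<in> {1..n} \<Longrightarrow>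
      G x y = F x y + (if P x then c * F (g x) y else 0)
        + (if P y then c * (F x (g y) + (if P x then c * F (g x) (g y) else 0)) else 0)"
  shows "det (vmat n G) = det (vmat n F)"
proof -
  let ?A = "\<lambda>x y. F x y + (if P x then c * F (g x) y else 0)"
  let ?B = "\<lambda>y x. ?A x y + (if P y then c * ?A x (g y) else 0)"
  have "det (vmat n G) = det (vmat n (\<lambda>x y. ?B y x))"
    by (rule arg_cong[of _ _ det], rule vmat_cong, subst G) auto
  also have "\<dots> = det (vmat n ?B)" by (rule det_vmat_transpose)
  also have "\<dots> = det (vmat n (\<lambda>y x. ?A x y))" by (rule det_vmat_add_rows[OF g])
  also have "\<dots> = det (vmat n ?A)" by (rule det_vmat_transpose)
  also have "\<dots> = det (vmat n F)" by (rule det_vmat_add_rows[OF g])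
  finally show ?thesis .
qed

lemma det_vmat_swap_rows:
  fixes F :: "nat \<Rightarrow> nat \<Rightarrow> 'a :: comm_ring_1"
  assumes "p \<in> {1..n}" "q \<in> {1..n}" "p \<noteq> q"
  shows "det (vmat n (\<lambda>x y. F (if x = p then q else if x = q then p else x) y)) = - det (vmat n F)"
proof -
  have "vmat n (\<lambda>x y. F (if x = p then q else if x = q then p else x) y)
      = swaprows (p - 1) (q - 1) (vmat n F)"
    using assms by (intro eq_matI) (auto simp: vmat_def)
  moreover have "p - 1 < n" "q - 1 < n" "p - 1 \<noteq> q - 1" using assms by auto
  ultimately show ?thesis using det_swaprows[of "p - 1" n "q - 1" "vmat n F"] by simp
qed

text \<open>A case of Sylvester's determinant identity: both sides are the determinant of the block
  matrix \<open>?M\<close>, once through the factorization \<open>?L * ?R\<close> and once through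
  the formula for commuting lower blocks.\<close>

lemma det_one_minus_mult_commute:
  fixes A B :: "'a :: idom mat"
  assumes A: "A \<in> carrier_mat n n" and B: "B \<in> carrier_mat n n"
  shows "det (1\<^sub>m n - A * B) = det (1\<^sub>m n - B * A)"
proof -
  let ?M = "four_block_mat (1\<^sub>m n) A B (1\<^sub>m n)"
  let ?L = "four_block_mat (1\<^sub>m n) (0\<^sub>m n n) B (1\<^sub>m n)"
  let ?R = "four_block_mat (1\<^sub>m n) A (0\<^sub>m n n) (1\<^sub>m n - B * A)"
  have R: "1\<^sub>m n - B * A \<in> carrier_mat n n"
    by (rule minus_carrier_mat[OF mult_carrier_mat[OF B A]])
  have "?L * ?R = four_block_mat (1\<^sub>m n * 1\<^sub>m n + 0\<^sub>m n n * 0\<^sub>m n n) (1\<^sub>m n * A + 0\<^sub>m n n * (1\<^sub>m n - B * A))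
      (B * 1\<^sub>m n + 1\<^sub>m n * 0\<^sub>m n n) (B * A + 1\<^sub>m n * (1\<^sub>m n - B * A))"
    by (rule mult_four_block_mat) (use A B in auto)
  also have "B * A + 1\<^sub>m n * (1\<^sub>m n - B * A) = 1\<^sub>m n"
    using A B by (intro eq_matI) auto
  finally have "?L * ?R = ?M" using A B by simp
  then have "det ?M = det ?L * det ?R"
    using det_mult[of ?L "n + n" ?R] R four_block_carrier_mat[of "1\<^sub>m n" n n "1\<^sub>m n" n n "0\<^sub>m n n" B]
      four_block_carrier_mat[of "1\<^sub>m n" n n "1\<^sub>m n - B * A" n n A "0\<^sub>m n n"] by simp
  also have "det ?L = 1"
    using det_four_block_mat_upper_right_zero[of "1\<^sub>m n" n "0\<^sub>m n n" n B "1\<^sub>m n"] B by simp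
  also have "det ?R = det (1\<^sub>m n - B * A)"
    using det_four_block_mat_lower_left_zero[of "1\<^sub>m n" n A n "0\<^sub>m n n" "1\<^sub>m n - B * A"] A R by simp
  finally have "det ?M = det (1\<^sub>m n - B * A)" by simp
  moreover have "det ?M = det (1\<^sub>m n - A * B)"
    using det_four_block_mat[of "1\<^sub>m n" n A B "1\<^sub>m n"] A B by simp
  ultimately show ?thesis by simp
qed

section \<open>Distances in rooted trees\<close>

lemma path_edges_Nil [simp]: "path_edges [] = {}"
  and path_edges_single [simp]: "path_edges [x] = {}"
  by (auto simp: path_edges_def)

lemma path_edges_Cons [simp]:
  fixes x y :: 'v
  shows "path_edges (x # y # xs) = insert {x, y} (path_edges (y # xs))"
proof -
  have A: "{m. Suc m < length (x # y # xs)} = insert 0 (Suc ` {m. Suc m < length (y # xs)})" (is "?A = ?B")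
  proof (rule Set.set_eqI)
    fix m show "m \<in> ?A \<longleftrightarrow> m \<in> ?B" by (cases m) auto
  qed
  have P: "path_edges zs = (\<lambda>m. {zs ! m, zs ! Suc m}) ` {m. Suc m < length zs}" for zs :: "'v list"
    by (auto simp: path_edges_def)
  show "path_edges (x # y # xs) = insert {x, y} (path_edges (y # xs))"
    unfolding P A image_insert image_image by simp
qed



lemma path_edges_subset_set: "f \<in> path_edges xs \<Longrightarrow> f \<subseteq> set xs"
  by (auto simp: path_edges_def)

text \<open>The strict descent of \<open>rk\<close> along \<open>par\<close> rules out cycles and
  makes every vertex reach \<open>q\<close>. Any such measure may serve as \<open>rk\<close>, not
  just the depth.\<close>

locale rooted_tree =
  fixes V :: "'v set" and q :: 'v and par :: "'v \<Rightarrow> 'v" and rk :: "'v \<Rightarrow> nat"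
  assumes finite_V: "finite V"
    and root: "q \<in> V"
    and par: "\<And>x. x \<in> V \<Longrightarrow> x \<noteq> q \<Longrightarrow> par x \<in> V \<and> rk (par x) < rk x"
begin

definition edges :: "'v set set" where
  "edges = (\<lambda>x. {x, par x}) ` (V - {q})"

definition below :: "'v \<Rightarrow> 'v \<Rightarrow> bool" where
  "below x z \<longleftrightarrow> (x, z) \<in> {(u, par u) | u. u \<in> V - {q}}\<^sup>*"

lemma below_refl [simp]: "below x x"
  by (simp add: below_def)

lemma below_root_iff: "below q z \<longleftrightarrow> z = q"
proof
  assume "below q z"
  then show "z = q" unfolding below_def by (cases rule: converse_rtranclE) auto
qed simp

lemma below_step_iff:
  assumes "x \<in> V" "x \<noteq> q"
  shows "below x z \<longleftrightarrow> x = z \<or> below (par x) z"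
proof
  assume "below x z"
  then show "x = z \<or> below (par x) z"
    unfolding below_def by (cases rule: converse_rtranclE) auto
next
  assume "x = z \<or> below (par x) z"
  then show "below x z"
    using assms unfolding below_def by (auto intro: converse_rtrancl_into_rtrancl)
qed

lemma below_rk:
  assumes "below x z"
  shows "rk z \<le> rk x"
  using assms unfolding below_def
proof (induction rule: converse_rtrancl_induct)
  case (step x y)
  then show ?case using par[of x] by auto
qed simp

lemma not_below_par:
  assumes "x \<in> V" "x \<noteq> q"
  shows "\<not> below (par x) x"
  using below_rk[of "par x" x] par[OF assms] by linarith

lemma below_antisym:
  assumes "below x z" "below z x" "x \<in> V"
  shows "x = z"
proof (cases "x = q")
  case False
  show ?thesis
  proof (rule ccontr)
    assume "x \<noteq> z"
    then have "below (par x) z" using assms below_step_iff False by blast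
    with assms(2) show False
      using below_rk[of "par x" z] below_rk[of z x] par[OF assms(3) False] by linarith
  qed
qed (use assms below_root_iff in auto)

text \<open>Two distinct vertices with the same parent edge would be parents of each other, against
  the descent of \<open>rk\<close>.\<close>

lemma inj_edge: "inj_on (\<lambda>x. {x, par x}) (V - {q})"
proof (rule inj_onI)
  fix x y assume "x \<in> V - {q}" "y \<in> V - {q}" "{x, par x} = {y, par y}"
  then show "x = y" using par[of x] par[of y] by (auto simp: doubleton_eq_iff)
qed

text \<open>Removing the edge above \<open>z\<close> cuts off exactly the vertices below
  \<open>z\<close>; every other edge stays on one side of the cut.\<close>

lemma below_edge:
  assumes f: "{u, v} \<in> edges" "{u, v} \<noteq> {z, par z}"
  shows "below u z \<longleftrightarrow> below v z"
proof -
  obtain x where x: "x \<in> V" "x \<noteq> q" "{u, v} = {x, par x}"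
    using f by (auto simp: edges_def)
  then have "x \<noteq> z" using f by auto
  then have "below x z \<longleftrightarrow> below (par x) z" using below_step_iff x by blast
  then show ?thesis using x(3) by (auto simp: doubleton_eq_iff)
qed


section \<open>Paths in a rooted tree\<close>

text \<open>Along a path, being below \<open>z\<close> changes only where the edge above
  \<open>z\<close> is crossed. Since vertices do not repeat, this happens at most once, hence
  precisely when the endpoints lie on different sides.\<close>

lemma path_edge_iff:
  assumes "is_path edges a b xs" "z \<in> V" "z \<noteq> q"
  shows "{z, par z} \<in> path_edges xs \<longleftrightarrow> below a z \<noteq> below b z"
  using assms(1)
proof (induction xs arbitrary: a)
  case (Cons x ys)
  show ?case
  proof (cases ys)
    case Nil
    then show ?thesis using Cons.prems by (auto simp: is_path_def)
  next
    case (Cons y zs)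
    have x: "a = x" "x \<notin> set ys" "{x, y} \<in> edges" and P: "is_path edges y b ys"
      using Cons.prems Cons by (auto simp: is_path_def)
    note IH = Cons.IH[OF P]
    show ?thesis
    proof (cases "{x, y} = {z, par z}")
      case True
      then have "below x z \<noteq> below y z"
        using not_below_par[OF assms(2,3)] by (auto simp: doubleton_eq_iff)
      moreover have "{z, par z} \<notin> path_edges ys"
        using x(2) path_edges_subset_set[of "{z, par z}" ys] True[symmetric] by auto
      ultimately show ?thesis using IH x True Cons by auto
    next
      case False
      then show ?thesis using below_edge[OF x(3) False] IH x Cons by auto
    qed
  qed
qed (simp add: is_path_def)

text \<open>The edges of a path thus depend on its endpoints only, which yields both the uniqueness
  of paths and the distance formula.\<close>

lemma path_edges_eq:
  assumes "is_path edges a b xs"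
  shows "path_edges xs = (\<lambda>z. {z, par z}) ` {z \<in> V - {q}. below a z \<noteq> below b z}"
proof -
  have "path_edges xs \<subseteq> edges" using assms by (simp add: is_path_def)
  then show ?thesis using path_edge_iff[OF assms] unfolding edges_def by blast
qed

text \<open>Both paths have the same edges. The first edge of one therefore occurs in the other, and
  it must be first there too, because the tail avoids the starting vertex.\<close>

lemma path_unique:
  assumes "is_path edges a b xs" "is_path edges a b ys"
  shows "xs = ys"
  using assms
proof (induction xs arbitrary: a ys)
  case (Cons x xs)
  obtain ys' where ys: "ys = x # ys'"
    using Cons.prems by (cases ys) (auto simp: is_path_def)
  show ?case
  proof (cases xs)
    case Nil
    then show ?thesis using Cons.prems ys by (auto simp: is_path_def split: if_splits)
  next
    case (Cons u us)
    then have xu: "x \<noteq> u" "{x, u} \<in> path_edges ys" "x \<notin> set xs"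
      using path_edges_eq[OF Cons.prems(1)] path_edges_eq[OF Cons.prems(2)] Cons.prems(1)
      by (auto simp: is_path_def)
    then obtain v vs where ys': "ys' = v # vs" using ys by (cases ys') auto
    have "{x, u} \<notin> path_edges ys'"
      using Cons.prems(2) ys path_edges_subset_set[of "{x, u}" ys'] by (auto simp: is_path_def)
    then have "v = u" using xu ys ys' by (auto simp: doubleton_eq_iff)
    moreover have "is_path edges u b xs" "is_path edges v b ys'"
      using Cons.prems ys ys' Cons by (auto simp: is_path_def)
    ultimately show ?thesis using Cons.IH ys by blast
  qed
qed (simp add: is_path_def)

text \<open>The zeta function of the subtree order, with real values so that it can enter
  distances.\<close>

definition zeta :: "'v \<Rightarrow> 'v \<Rightarrow> real" where
  "zeta x z = of_bool (below x z)"

text \<open>The edge from \<open>z\<close> to its parent separates \<open>x\<close> from \<open>y\<close> iff exactly one of them lies below \<open>z\<close>.\<close>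

definition rdist :: "('v \<Rightarrow> real) \<Rightarrow> 'v \<Rightarrow> 'v \<Rightarrow> real" where
  "rdist \<omega> x y = (\<Sum>z\<in>V - {q}. \<omega> z * (zeta x z - zeta y z)\<^sup>2)"

text \<open>Edges are renamed by their lower ends: a non-root vertex \<open>z\<close> stands for the
  index \<open>s\<close> with \<open>e s = {z, par z}\<close>.\<close>

lemma tree_dist_eq_rdist:
  assumes e: "bij_betw e S edges" and path: "is_path edges a b xs"
  shows "tree_dist S e w a b = rdist (\<lambda>z. w (inv_into S e {z, par z})) a b"
proof -
  let ?f = "\<lambda>z. inv_into S e {z, par z}" and ?A = "{z \<in> V - {q}. below a z \<noteq> below b z}"
  have "the_path edges a b = xs"
    unfolding the_path_def using path path_unique by (intro the_equality) auto
  moreover have eS: "e ` S = edges" using e by (simp add: bij_betw_def)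
  ultimately have "tree_dist S e w a b = (\<Sum>s | s \<in> S \<and> e s \<in> (\<lambda>z. {z, par z}) ` ?A. w s)"
    using path_edges_eq[OF path] by (simp add: tree_dist_def)
  also have "{s. s \<in> S \<and> e s \<in> (\<lambda>z. {z, par z}) ` ?A} = ?f ` ?A"
  proof (intro equalityI subsetI)
    fix s assume s: "s \<in> {s. s \<in> S \<and> e s \<in> (\<lambda>z. {z, par z}) ` ?A}"
    then obtain z where "z \<in> ?A" "e s = {z, par z}" by blast
    then have "?f z = s" using s e inv_into_f_f[of e S s] by (auto simp: bij_betw_def)
    then show "s \<in> ?f ` ?A" using \<open>z \<in> ?A\<close> by blast
  next
    fix s assume "s \<in> ?f ` ?A"
    then obtain z where z: "z \<in> ?A" "s = ?f z" by blast
    then have "{z, par z} \<in> e ` S" using eS by (auto simp: edges_def)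
    then show "s \<in> {s. s \<in> S \<and> e s \<in> (\<lambda>z. {z, par z}) ` ?A}"
      using z f_inv_into_f[of "{z, par z}" e S] inv_into_into[of "{z, par z}" e S] by auto
  qed
  also have "(\<Sum>s\<in>?f ` ?A. w s) = (\<Sum>z\<in>?A. w (?f z))"
  proof (rule sum.reindex_cong[OF _ refl refl])
    have "inj_on (inv_into S e) ((\<lambda>z. {z, par z}) ` ?A)"
      by (rule inj_on_inv_into) (auto simp: eS edges_def)
    then show "inj_on ?f ?A"
      using comp_inj_on[OF inj_on_subset[OF inj_edge, of ?A]] by (auto simp: comp_def)
  qed
  also have "\<dots> = rdist (\<lambda>z. w (?f z)) a b"
    unfolding rdist_def zeta_def using finite_V
    by (intro sum.mono_neutral_cong_left) auto
  finally show ?thesis .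
qed

section \<open>Differences of distances along parent edges\<close>

lemma zeta_step:
  assumes "x \<in> V" "x \<noteq> q"
  shows "zeta x z = of_bool (x = z) + zeta (par x) z"
  using below_step_iff[OF assms, of z] not_below_par[OF assms] by (auto simp: zeta_def)

lemma zeta_refl [simp]: "zeta x x = 1"
  by (simp add: zeta_def)

lemma zeta_par_self: "x \<in> V \<Longrightarrow> x \<noteq> q \<Longrightarrow> zeta (par x) x = 0"
  by (simp add: zeta_def not_below_par)

lemma zeta_root: "x \<noteq> q \<Longrightarrow> zeta q x = 0"
  by (simp add: zeta_def below_root_iff)

lemma zeta_mult_swap: "x \<in> V \<Longrightarrow> zeta x y * zeta y x = of_bool (x = y)"
  using below_antisym[of x y] by (auto simp: zeta_def)

lemma rdist_self [simp]: "rdist \<omega> x x = 0"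
  by (simp add: rdist_def)

lemma rdist_commute: "rdist \<omega> x y = rdist \<omega> y x"
  by (simp add: rdist_def power2_commute)

text \<open>Moving from \<open>x\<close> to its parent changes \<open>zeta\<close> at
  \<open>z = x\<close> only, so a single summand changes. The sign is negative if \<open>y\<close>
  lies below \<open>x\<close> and positive otherwise.\<close>

lemma rdist_step:
  assumes x: "x \<in> V" "x \<noteq> q"
  shows "rdist \<omega> x y = rdist \<omega> (par x) y + \<omega> x * (1 - 2 * zeta y x)"
proof -
  have "rdist \<omega> x y - rdist \<omega> (par x) y
      = (\<Sum>z\<in>V - {q}. \<omega> z * ((zeta x z - zeta y z)\<^sup>2 - (zeta (par x) z - zeta y z)\<^sup>2))"
    by (simp add: rdist_def sum_subtractf right_diff_distrib)
  also have "\<dots> = (\<Sum>z\<in>{x}. \<omega> z * ((zeta x z - zeta y z)\<^sup>2 - (zeta (par x) z - zeta y z)\<^sup>2))"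
    using x finite_V zeta_step[OF x] by (intro sum.mono_neutral_right) auto
  also have "\<dots> = \<omega> x * (1 - 2 * zeta y x)"
    using zeta_par_self[OF x] by (simp add: power2_eq_square algebra_simps)
  finally show ?thesis by simp
qed

text \<open>For \<open>x \<noteq> y\<close> the four distances are D, D + a, D + b and D + a + b,
  where a and b are \<omega> x and \<omega> y up to sign, so the mixed difference of squares is 2 a
  b. The product of the two signs has no quadratic term, since distinct vertices are not below each
  other. For \<open>x = y\<close> the distances are 0, \<omega> x, \<omega> x, 0, which accounts for
  the \<open>of_bool\<close> summand.\<close>

lemma rdist_sq_mixed_diff:
  assumes x: "x \<in> V" "x \<noteq> q" and y: "y \<in> V" "y \<noteq> q"
  shows "(rdist \<omega> x y)\<^sup>2 - (rdist \<omega> (par x) y)\<^sup>2 - (rdist \<omega> x (par y))\<^sup>2 + (rdist \<omega> (par x) (par y))\<^sup>2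
    = \<omega> x * \<omega> y * (2 * (1 - 2 * zeta x y - 2 * zeta y x + 2 * of_bool (x = y)))"
proof -
  define D where "D = rdist \<omega> (par x) (par y)"
  have py: "rdist \<omega> u y = rdist \<omega> u (par y) + \<omega> y * (1 - 2 * zeta u y)" for u
    using rdist_step[OF y, of \<omega> u] by (simp add: rdist_commute)
  have 1: "rdist \<omega> x (par y) = D + \<omega> x * (1 - 2 * zeta (par y) x)"
    using rdist_step[OF x, of \<omega> "par y"] by (simp add: D_def)
  have 2: "rdist \<omega> (par x) y = D + \<omega> y * (1 - 2 * zeta (par x) y)"
    using py[of "par x"] by (simp add: D_def)
  have 3: "rdist \<omega> x y = D + \<omega> y * (1 - 2 * zeta (par x) y) + \<omega> x * (1 - 2 * zeta y x)"
    using rdist_step[OF x, of \<omega> y] 2 by simp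
  show ?thesis
  proof (cases "x = y")
    case True
    then show ?thesis
      using zeta_par_self[OF x] unfolding 1 2 3 D_def
      by (simp add: power2_eq_square algebra_simps)
  next
    case False
    have "zeta x y = 0 \<or> zeta y x = 0" using zeta_mult_swap[OF x(1), of y] False by simp
    moreover have "zeta (par x) y = zeta x y" "zeta (par y) x = zeta y x"
      using zeta_step[OF x, of y] zeta_step[OF y, of x] False by auto
    ultimately show ?thesis
      unfolding 1 2 3 D_def[symmetric] using False by (auto simp: power2_eq_square algebra_simps)
  qed
qed

end

section \<open>The squared distance matrix\<close>

locale numbered_tree = rooted_tree "{1..n}" q par rk
  for n :: nat and q :: nat and par :: "nat \<Rightarrow> nat" and rk :: "nat \<Rightarrow> nat"
begin

definition children :: "nat \<Rightarrow> nat set" where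
  "children v = {x \<in> {1..n} - {q}. par x = v}"

text \<open>Besides its children, a non-root vertex has its parent as a neighbour; by the descent of
  \<open>rk\<close> the parent is not also a child.\<close>

lemma tau_edges:
  assumes "v \<in> {1..n}" "v \<noteq> q"
  shows "tau edges v = 1 - int (card (children v))"
proof -
  have "neighbours edges v = insert (par v) (children v)"
    using assms by (auto simp: neighbours_def edges_def children_def doubleton_eq_iff)
  moreover have "par v \<notin> children v"
    using par[of v] par[of "par v"] assms by (auto simp: children_def)
  moreover have "finite (children v)" by (simp add: children_def)
  ultimately show ?thesis by (simp add: tau_def vdegree_def)
qed

lemma neighbours_root: "neighbours edges q = children q"
  by (auto simp: neighbours_def edges_def children_def doubleton_eq_iff)

text \<open>The block of the children of a vertex other than \<open>q\<close> is I - J, J being the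
  all-ones matrix. On the root and its children the matrix is the identity, which leaves room for
  the special treatment of \<open>q\<close>.\<close>

definition sibling_mat :: "nat \<Rightarrow> nat \<Rightarrow> real" where
  "sibling_mat x y = of_bool (x = y) - of_bool (x \<noteq> q \<and> y \<noteq> q \<and> par x = par y \<and> par x \<noteq> q)"

text \<open>With \<open>A\<close> the child-parent incidence matrix (edges to the root omitted) this is
  \<open>I - A A\<^sup>T\<close>, whereas \<open>I - A\<^sup>T A\<close> is diagonal.\<close>

lemma det_sibling_mat:
  "det (vmat n sibling_mat) = (\<Prod>v\<in>{1..n} - {q}. of_int (tau edges v))"
proof -
  define A :: "nat \<Rightarrow> nat \<Rightarrow> real" where "A x z = of_bool (x \<noteq> q \<and> z \<noteq> q \<and> par x = z)" for x z
  let ?\<delta> = "\<lambda>x y. of_bool (x = y) :: real"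
  let ?D = "\<lambda>x y. ?\<delta> x y - (\<Sum>z\<in>{1..n}. A z x * A z y)"
  have one: "vmat n ?\<delta> = 1\<^sub>m n" by (intro eq_matI) (auto simp: vmat_def)
  have minus: "vmat n F - vmat n G = vmat n (\<lambda>x y. F x y - G x y)" for F G :: "nat \<Rightarrow> nat \<Rightarrow> real"
    by (intro eq_matI) (auto simp: vmat_def)
  have "vmat n sibling_mat = vmat n (\<lambda>x y. ?\<delta> x y - (\<Sum>z\<in>{1..n}. A x z * A y z))"
  proof (rule vmat_cong)
    fix x y assume xy: "x \<in> {1..n}" "y \<in> {1..n}"
    have "(\<Sum>z\<in>{1..n}. A x z * A y z)
        = (\<Sum>z\<in>{1..n}. if z = par x then of_bool (x \<noteq> q \<and> y \<noteq> q \<and> par x = par y \<and> par x \<noteq> q) else 0)"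
      by (rule sum.cong) (auto simp: A_def)
    also have "\<dots> = of_bool (x \<noteq> q \<and> y \<noteq> q \<and> par x = par y \<and> par x \<noteq> q)"
      using par[OF xy(1)] by (auto simp del: atLeastAtMost_iff)
    finally show "sibling_mat x y = ?\<delta> x y - (\<Sum>z\<in>{1..n}. A x z * A y z)"
      by (simp add: sibling_mat_def)
  qed
  also have "\<dots> = 1\<^sub>m n - vmat n A * vmat n (\<lambda>x y. A y x)"
    by (simp add: vmat_mult one[symmetric] minus)
  also have "det \<dots> = det (1\<^sub>m n - vmat n (\<lambda>x y. A y x) * vmat n A)"
    by (rule det_one_minus_mult_commute) simp_all
  also have "1\<^sub>m n - vmat n (\<lambda>x y. A y x) * vmat n A = vmat n ?D"
    by (simp add: vmat_mult one[symmetric] minus)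
  also have "det (vmat n ?D) = (\<Prod>x\<in>{1..n}. ?D x x)"
  proof (rule det_vmat_triangular[of n ?D "\<lambda>_. 0"])
    fix x y assume "?D x y \<noteq> 0"
    \<comment> \<open>A vertex has just one parent, so distinct columns of \<open>A\<close> have
      disjoint supports.\<close>
    moreover have "(\<Sum>z\<in>{1..n}. A z x * A z y) = 0" if "x \<noteq> y"
      by (rule sum.neutral) (use that in \<open>auto simp: A_def\<close>)
    ultimately show "x = y \<or> (0::nat) < 0" by (cases "x = y") simp_all
  qed
  also have "\<dots> = (\<Prod>v\<in>{1..n} - {q}. of_int (tau edges v))"
  proof (rule prod.mono_neutral_cong_right)
    \<comment> \<open>Edges to the root are omitted from \<open>A\<close>, so its column at
      \<open>q\<close> is zero and the root contributes the factor 1.\<close>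
    show "\<forall>x\<in>{1..n} - ({1..n} - {q}). ?D x x = 1" by (auto simp: A_def)
    fix x assume x: "x \<in> {1..n} - {q}"
    have "(\<Sum>z\<in>{1..n}. A z x * A z x) = (\<Sum>z\<in>{1..n}. if z \<in> children x then 1 else 0)"
      using x by (intro sum.cong) (auto simp: A_def children_def)
    also have "\<dots> = real (card (children x))"
      by (subst sum.inter_restrict[symmetric]) (auto simp: children_def Int_def intro!: arg_cong[of _ _ card])
    finally show "?D x x = of_int (tau edges x)" using x by (simp add: tau_edges)
  qed auto
  finally show ?thesis .
qed

section \<open>Reduction of the squared distance matrix by two differencings\<close>

context
  fixes \<omega> :: "nat \<Rightarrow> real"
begin

text \<open>The matrix after the first differencing, with a weight taken out of each non-root row
  and column. The border entries are the cofactors of \<omega> x in the differences of the squared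
  distances to the root.\<close>

definition diff_mat :: "nat \<Rightarrow> nat \<Rightarrow> real" where
  "diff_mat x y = (if x = q then (if y = q then 0 else 2 * rdist \<omega> (par y) q + \<omega> y)
     else if y = q then 2 * rdist \<omega> (par x) q + \<omega> x
     else 2 * (1 - 2 * zeta x y - 2 * zeta y x + 2 * of_bool (x = y)))"

text \<open>The border entry of \<open>diff_mat\<close> at \<open>x\<close> minus the one at its
  parent: the distances to the root differ by \<omega> (par x), which leaves 2 \<omega> (par x) +
  \<omega> x - \<omega> (par x). At a child of the root nothing is subtracted and the distance of
  its parent is 0.\<close>

definition border :: "nat \<Rightarrow> real" where
  "border x = \<omega> x + (if par x = q then 0 else \<omega> (par x))"

text \<open>The matrix after the second differencing, which spares the children of the root. Their
  block is 2 J - 4 I, singular when there are two of them.\<close>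

definition border_mat :: "nat \<Rightarrow> nat \<Rightarrow> real" where
  "border_mat x y = (if x = q then (if y = q then 0 else border y)
     else if y = q then border x
     else 2 * of_bool (par x = q \<and> par y = q) - 4 * sibling_mat x y)"

lemma det_sq_rdist_diff_mat:
  "det (vmat n (\<lambda>x y. (rdist \<omega> x y)\<^sup>2)) = (\<Prod>x\<in>{1..n} - {q}. \<omega> x)\<^sup>2 * det (vmat n diff_mat)"
proof -
  \<comment> \<open>The root has no parent edge, so its row and column carry no weight.\<close>
  let ?\<omega> = "\<lambda>x. if x = q then 1 else \<omega> x"
  let ?G = "\<lambda>x y. ?\<omega> x * ?\<omega> y * diff_mat x y"
  have "det (vmat n ?G) = det (vmat n (\<lambda>x y. (rdist \<omega> x y)\<^sup>2))"
  proof (rule det_vmat_add_rows_cols[of n "\<lambda>x. x \<noteq> q" par rk ?G _ "-1"])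
    show "par x \<in> {1..n} \<and> rk (par x) < rk x" if "x \<in> {1..n}" "x \<noteq> q" for x
      using par that by blast
    have step: "(rdist \<omega> x q)\<^sup>2 - (rdist \<omega> (par x) q)\<^sup>2 = \<omega> x * (2 * rdist \<omega> (par x) q + \<omega> x)"
      if "x \<in> {1..n}" "x \<noteq> q" for x
      using rdist_step[OF that, of \<omega> q] zeta_root[OF that(2)]
      by (simp add: power2_eq_square algebra_simps)
    fix x y assume x: "x \<in> {1..n}" and y: "y \<in> {1..n}"
    show "?G x y = (rdist \<omega> x y)\<^sup>2 + (if x \<noteq> q then - 1 * (rdist \<omega> (par x) y)\<^sup>2 else 0)
        + (if y \<noteq> q then - 1 * ((rdist \<omega> x (par y))\<^sup>2 + (if x \<noteq> q then - 1 * (rdist \<omega> (par x) (par y))\<^sup>2 else 0)) else 0)"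
    proof (cases "x = q"; cases "y = q")
      assume "x \<noteq> q" "y \<noteq> q"
      then show ?thesis using rdist_sq_mixed_diff[OF x _ y, of \<omega>] by (simp add: diff_mat_def algebra_simps)
    next
      assume "x = q" "y \<noteq> q"
      then show ?thesis using step[OF y] by (simp add: diff_mat_def rdist_commute[of \<omega> q])
    next
      assume "x \<noteq> q" "y = q"
      then show ?thesis using step[OF x] by (simp add: diff_mat_def)
    qed (simp add: diff_mat_def)
  qed
  moreover have "det (vmat n ?G) = (\<Prod>x\<in>{1..n}. ?\<omega> x)\<^sup>2 * det (vmat n diff_mat)"
    by (rule det_vmat_scale_both)
  moreover have "(\<Prod>x\<in>{1..n}. ?\<omega> x) = (\<Prod>x\<in>{1..n} - {q}. \<omega> x)"
    by (rule prod.mono_neutral_cong_right) auto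
  ultimately show ?thesis by simp
qed

text \<open>When neither parent is the root, the constant cancels and \<open>zeta\<close>
  differences to equality indicators. The parent-child indicators from \<open>zeta\<close> cancel
  those from the diagonal term, so only "equal" and "siblings" survive.\<close>

lemma det_diff_mat: "det (vmat n diff_mat) = det (vmat n border_mat)"
proof (rule det_vmat_add_rows_cols[of n "\<lambda>x. x \<noteq> q \<and> par x \<noteq> q" par rk border_mat diff_mat "-1", symmetric])
  show "par x \<in> {1..n} \<and> rk (par x) < rk x" if "x \<in> {1..n}" "x \<noteq> q \<and> par x \<noteq> q" for x
    using par that by blast
  fix x y assume x: "x \<in> {1..n}" and y: "y \<in> {1..n}"
  have root: "2 * rdist \<omega> (par x) q + \<omega> x - (if par x \<noteq> q then 2 * rdist \<omega> (par (par x)) q + \<omega> (par x) else 0) = border x"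
    if "x \<in> {1..n}" "x \<noteq> q" for x
    using rdist_step[of "par x" \<omega> q] zeta_root[of "par x"] par[OF that] by (auto simp: border_def)
  show "border_mat x y = diff_mat x y + (if x \<noteq> q \<and> par x \<noteq> q then - 1 * diff_mat (par x) y else 0)
      + (if y \<noteq> q \<and> par y \<noteq> q then - 1 * (diff_mat x (par y) + (if x \<noteq> q \<and> par x \<noteq> q then - 1 * diff_mat (par x) (par y) else 0)) else 0)"
  proof (cases "x = q"; cases "y = q")
    assume xq: "x \<noteq> q" and yq: "y \<noteq> q"
    \<comment> \<open>The equalities are turned around so that they match the indicators coming from
      \<open>zeta x y\<close> and cancel.\<close>
    have y1: "zeta y x = of_bool (x = y) + zeta (par y) x"
      and y2: "zeta y (par x) = of_bool (par x = y) + zeta (par y) (par x)"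
      using zeta_step[OF y yq] by (simp_all only: eq_commute)
    note z = zeta_step[OF x xq, of y] zeta_step[OF x xq, of "par y"] y1 y2
    show ?thesis
    proof (cases "par x = q"; cases "par y = q")
      assume "par x \<noteq> q" "par y \<noteq> q"
      then show ?thesis using xq yq unfolding diff_mat_def border_mat_def sibling_mat_def z by simp
    next
      assume h: "par x = q" "par y \<noteq> q"
      have "zeta q y = 0" "zeta q (par y) = 0" using zeta_root yq h(2) by blast+
      then show ?thesis using xq yq h unfolding diff_mat_def border_mat_def sibling_mat_def z by simp
    next
      assume h: "par x \<noteq> q" "par y = q"
      have "zeta q x = 0" "zeta q (par x) = 0" using zeta_root xq h(1) by blast+
      then show ?thesis using xq yq h unfolding diff_mat_def border_mat_def sibling_mat_def z by simp
    next
      assume h: "par x = q" "par y = q"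
      have "zeta q x = 0" "zeta q y = 0" using zeta_root xq yq by blast+
      then show ?thesis using xq yq h unfolding diff_mat_def border_mat_def sibling_mat_def z by simp
    qed
  next
    assume "x = q" "y \<noteq> q"
    then show ?thesis using root[OF y] by (cases "par y = q") (simp_all add: diff_mat_def border_mat_def)
  next
    assume "x \<noteq> q" "y = q"
    then show ?thesis using root[OF x] by (cases "par x = q") (simp_all add: diff_mat_def border_mat_def)
  qed (simp add: diff_mat_def border_mat_def)
qed


text \<open>Adding the row and the column of \<open>r\<close> to those of \<open>p\<close> leaves in row and column \<open>p\<close> only the
  entry at the root; after exchanging rows \<open>p\<close> and \<open>q\<close> the matrix is triangular apart from the
  sibling block.\<close>

lemma det_border_mat:
  assumes pr: "children q = {p, r}" "p \<noteq> r"
  shows "det (vmat n border_mat) = 2 * (\<omega> p + \<omega> r)\<^sup>2 * (-4) ^ (n - 3) * (\<Prod>v\<in>{1..n} - {q}. of_int (tau edges v))"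
proof -
  define s where "s = \<omega> p + \<omega> r"
  have q: "q \<in> {1..n}" and p: "p \<in> {1..n}" "p \<noteq> q" "par p = q" and r: "r \<in> {1..n}" "r \<noteq> q" "par r = q"
    using root pr(1) unfolding children_def by blast+
  have top: "par x = q \<longleftrightarrow> x = p \<or> x = r" if "x \<in> {1..n}" "x \<noteq> q" for x
    using that pr(1) unfolding children_def by blast
  \<comment> \<open>Before the operation the border entries at \<open>p\<close> and \<open>r\<close>
    are \<omega> p and \<omega> r; adding \<open>r\<close> to \<open>p\<close> gives
    \<open>s\<close>.\<close>
  define c' where "c' y = (if y = p then s else border y)" for y
  \<comment> \<open>The block of \<open>p\<close> and \<open>r\<close>, with -2 on and 2 off its
    diagonal, becomes diagonal with entries 0 and -2.\<close>
  define G where "G x y = (if x = q then (if y = q then 0 else c' y)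
     else if y = q then c' x
     else if x = p \<or> y = p then 0
     else if x = r then -2 * of_bool (x = y)
     else -4 * sibling_mat x y)" for x y
  have "det (vmat n G) = det (vmat n border_mat)"
  proof (rule det_vmat_add_rows_cols[of n "\<lambda>x. x = p" "\<lambda>_. r" "\<lambda>x. of_bool (x = p)" _ _ 1])
    show "r \<in> {1..n} \<and> of_bool (r = p) < (of_bool (x = p) :: nat)" if "x = p" for x
      using r(1) pr(2) that by simp
    have cc: "border p = \<omega> p" "border r = \<omega> r" using p r by (auto simp: border_def)
    fix x y assume x: "x \<in> {1..n}" and y: "y \<in> {1..n}"
    note H = G_def border_mat_def sibling_mat_def c'_def s_def
    show "G x y = border_mat x y + (if x = p then 1 * border_mat r y else 0)
      + (if y = p then 1 * (border_mat x r + (if x = p then 1 * border_mat r r else 0)) else 0)"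
    proof (cases "x = q \<or> y = q")
      case True
      then show ?thesis using p r pr(2) by (auto simp: H cc)
    next
      case False
      then show ?thesis
        using top[OF x] top[OF y] p r pr(2)
        by (cases "x = p"; cases "y = p"; cases "x = r"; cases "y = r") (simp_all add: H)
    qed
  qed
  moreover define K where "K x y = G (if x = p then q else if x = q then p else x) y" for x y
  have "det (vmat n K) = - det (vmat n G)"
    using det_vmat_swap_rows[OF p(1) q p(2), of G] by (simp only: K_def[abs_def])
  \<comment> \<open>\<open>K\<close> will be factored as \<open>X\<close>, \<open>B\<close>,
    \<open>Y\<close> in this order: \<open>X\<close> differs from the identity only in column
    \<open>q\<close>, \<open>Y\<close> only in row \<open>p\<close>, each with \<open>s\<close> on
    the diagonal there, and \<open>B\<close> holds the scaled sibling block.\<close>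
  moreover define X where "X x y = (if y = q then (if x = q then s else if x = p then 0 else border x)
      else of_bool (x = y))" for x y
  define Y where "Y x y = (if x = p then (if y = q then 0 else c' y) else of_bool (x = y))" for x y
  \<comment> \<open>The value 1 makes rows \<open>p\<close> and \<open>q\<close> of \<open>B\<close>
    unit rows, as their contents sit in \<open>Y\<close> and \<open>X\<close>; -2 is the remaining
    entry at \<open>r\<close>, and -4 is the factor of \<open>sibling_mat\<close> in
    \<open>border_mat\<close>.\<close>
  define \<kappa> :: "nat \<Rightarrow> real" where "\<kappa> x = (if x = p \<or> x = q then 1 else if x = r then -2 else -4)" for x
  define B where "B x y = \<kappa> x * sibling_mat x y" for x y
  define BY where "BY x y = (\<Sum>z\<in>{1..n}. B x z * Y z y)" for x y
  \<comment> \<open>Row and column \<open>p\<close> of \<open>B\<close> are those of the identity,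
    so multiplying by \<open>Y\<close> replaces only row \<open>p\<close>.\<close>
  have BY: "BY x y = (if x = p then Y p y else B x y)" if x: "x \<in> {1..n}" and y: "y \<in> {1..n}" for x y
  proof (cases "x = p")
    case True
    then have "BY x y = (\<Sum>z\<in>{1..n}. if z = p then Y p y else 0)"
      unfolding BY_def by (intro sum.cong) (auto simp: B_def \<kappa>_def sibling_mat_def p)
    then show ?thesis using p(1) True by (simp del: atLeastAtMost_iff)
  next
    case False
    then have "BY x y = (\<Sum>z\<in>{1..n}. if z = y then B x y else 0)"
      unfolding BY_def by (intro sum.cong) (use p in \<open>auto simp: B_def sibling_mat_def Y_def\<close>)
    then show ?thesis using y False by (simp del: atLeastAtMost_iff)
  qed
  have "vmat n K = vmat n (\<lambda>x y. \<Sum>z\<in>{1..n}. X x z * BY z y)"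
  proof (rule vmat_cong)
    fix x y assume x: "x \<in> {1..n}" and y: "y \<in> {1..n}"
    have "(\<Sum>z\<in>{1..n}. X x z * BY z y) = X x q * BY q y + (\<Sum>z\<in>{1..n} - {q}. X x z * BY z y)"
      by (rule sum.remove) (use q in auto)
    also have "(\<Sum>z\<in>{1..n} - {q}. X x z * BY z y) = (\<Sum>z\<in>{1..n} - {q}. if x = z then BY x y else 0)"
      by (rule sum.cong) (auto simp: X_def)
    also have "\<dots> = (if x = q then 0 else BY x y)"
      using x by (simp del: atLeastAtMost_iff)
    also have "BY q y = of_bool (q = y)"
      using BY[OF q y] p(2) by (simp add: B_def \<kappa>_def sibling_mat_def)
    finally have "(\<Sum>z\<in>{1..n}. X x z * BY z y) = X x q * of_bool (q = y) + (if x = q then 0 else BY x y)" .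
    moreover have "K x y = X x q * of_bool (q = y) + (if x = q then 0 else BY x y)"
      unfolding BY[OF x y]
    proof (cases "x = p \<or> x = q")
      case True
      then show "K x y = X x q * of_bool (q = y) + (if x = q then 0 else if x = p then Y p y else B x y)"
        using p(2) by (auto simp: K_def G_def X_def Y_def c'_def)
    next
      case False
      then show "K x y = X x q * of_bool (q = y) + (if x = q then 0 else if x = p then Y p y else B x y)"
        using p r pr(2) by (auto simp: K_def G_def X_def B_def \<kappa>_def sibling_mat_def c'_def)
    qed
    ultimately show "K x y = (\<Sum>z\<in>{1..n}. X x z * BY z y)" by simp
  qed
  moreover have "det (vmat n (\<lambda>x y. \<Sum>z\<in>{1..n}. X x z * BY z y)) = det (vmat n X) * det (vmat n BY)"
    by (rule det_vmat_mult)
  moreover have "det (vmat n BY) = det (vmat n B) * det (vmat n Y)"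
    unfolding BY_def[abs_def] by (rule det_vmat_mult)
  moreover have "det (vmat n X) = s"
  proof -
    have "det (vmat n X) = (\<Prod>x\<in>{1..n}. X x x)"
      by (rule det_vmat_triangular[of n X "\<lambda>x. of_bool (x \<noteq> q)"]) (auto simp: X_def split: if_splits)
    also have "\<dots> = (\<Prod>x\<in>{1..n}. if x = q then s else 1)"
      by (rule prod.cong) (auto simp: X_def)
    finally show ?thesis using q by (simp del: atLeastAtMost_iff)
  qed
  moreover have "det (vmat n Y) = s"
  proof -
    have "det (vmat n Y) = (\<Prod>x\<in>{1..n}. Y x x)"
      by (rule det_vmat_triangular[of n Y "\<lambda>x. of_bool (x = p)"]) (auto simp: Y_def split: if_splits)
    also have "\<dots> = (\<Prod>x\<in>{1..n}. if x = p then s else 1)"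
      using p(2) by (intro prod.cong) (auto simp: Y_def c'_def)
    finally show ?thesis using p by (simp del: atLeastAtMost_iff)
  qed
  moreover have "det (vmat n B) = (\<Prod>x\<in>{1..n}. \<kappa> x) * (\<Prod>v\<in>{1..n} - {q}. of_int (tau edges v))"
    unfolding B_def[abs_def] by (simp only: det_vmat_scale_rows det_sibling_mat)
  \<comment> \<open>The three exceptional vertices give -2, which the sign of the row exchange
    finally turns into 2.\<close>
  moreover have "(\<Prod>x\<in>{1..n}. \<kappa> x) = -2 * (-4) ^ (n - 3)"
  proof -
    have "{1..n} = {p, q, r} \<union> ({1..n} - {p, q, r})" using p q r by blast
    then have "(\<Prod>x\<in>{1..n}. \<kappa> x) = (\<Prod>x\<in>{p, q, r}. \<kappa> x) * (\<Prod>x\<in>{1..n} - {p, q, r}. \<kappa> x)"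
      by (metis (no_types) Diff_disjoint finite_Un finite_atLeastAtMost prod.union_disjoint)
    also have "(\<Prod>x\<in>{p, q, r}. \<kappa> x) = -2"
      using p(2) r(2) pr(2) by (auto simp: \<kappa>_def)
    also have "(\<Prod>x\<in>{1..n} - {p, q, r}. \<kappa> x) = (\<Prod>x\<in>{1..n} - {p, q, r}. -4)"
      by (rule prod.cong) (auto simp: \<kappa>_def)
    also have "\<dots> = (-4) ^ (n - 3)"
      using p q r pr(2) by (simp add: card_Diff_subset card_insert_if numeral_3_eq_3)
    finally show ?thesis .
  qed
  ultimately show ?thesis
    by (simp add: s_def[symmetric] power2_eq_square mult_ac)
qed

lemma det_sq_rdist:
  assumes "children q = {p, r}" "p \<noteq> r"
  shows "det (vmat n (\<lambda>x y. (rdist \<omega> x y)\<^sup>2)) = 2 * (-4) ^ (n - 3) * (\<omega> p + \<omega> r)\<^sup>2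
    * (\<Prod>x\<in>{1..n} - {q}. \<omega> x)\<^sup>2 * (\<Prod>v\<in>{1..n} - {q}. of_int (tau edges v))"
  by (simp add: det_sq_rdist_diff_mat det_diff_mat det_border_mat[OF assms])

end

end

section \<open>From trees to rooted trees, and the determinant formula\<close>

text \<open>The parent of \<open>x\<close> is taken to be the second vertex of a shortest path to
  \<open>q\<close>. The parent edges are \<open>card V - 1\<close> distinct members of
  \<open>E\<close>, so by cardinality they are all of \<open>E\<close>.\<close>

lemma tree_rooted_at:
  assumes tree: "is_tree V E" and q: "q \<in> V" and card: "card E = card V - 1"
  obtains par rk where "rooted_tree V q par rk" "rooted_tree.edges V q par = E"
proof -
  have V: "finite V" and E: "\<And>f. f \<in> E \<Longrightarrow> f \<subseteq> V"
    using tree by (auto simp: is_tree_def simple_graph_def)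
  \<comment> \<open>Counts the vertices of a shortest path to \<open>q\<close>, so dropping the
    first vertex of such a path lowers it.\<close>
  define rk where "rk x = (LEAST k. \<exists>xs. is_path E x q xs \<and> length xs = k)" for x
  have "\<exists>y. {x, y} \<in> E \<and> rk y < rk x" if x: "x \<in> V" "x \<noteq> q" for x
  proof -
    have "\<exists>k xs. is_path E x q xs \<and> length xs = k"
      using tree x q by (auto simp: is_tree_def)
    from LeastI_ex[OF this] obtain xs where xs: "is_path E x q xs" "length xs = rk x"
      unfolding rk_def by blast
    then obtain y zs where yz: "xs = x # y # zs"
      using x(2) by (cases xs; cases "tl xs") (auto simp: is_path_def)
    then have "{x, y} \<in> E" "is_path E y q (y # zs)"
      using xs(1) by (auto simp: is_path_def)
    moreover from this have "rk y \<le> length (y # zs)"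
      unfolding rk_def by (intro Least_le) blast
    ultimately show ?thesis using xs(2) yz by auto
  qed
  then obtain par where step: "\<And>x. x \<in> V \<Longrightarrow> x \<noteq> q \<Longrightarrow> {x, par x} \<in> E \<and> rk (par x) < rk x"
    by metis
  interpret rooted_tree V q par rk
  proof
    show "par x \<in> V \<and> rk (par x) < rk x" if "x \<in> V" "x \<noteq> q" for x
      using step[OF that] E[of "{x, par x}"] by blast
  qed (rule V q)+
  have "finite E" using E V by (meson Pow_iff finite_Pow_iff finite_subset subsetI)
  moreover have "edges \<subseteq> E" using step by (auto simp: edges_def)
  moreover have "card edges = card E"
    using card q V by (simp add: edges_def card_image[OF inj_edge])
  ultimately have "edges = E" by (rule card_subset_eq)
  then show ?thesis using that rooted_tree_axioms by blast
qed

theorem theorem3p3: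
  fixes n p q r i j :: nat
    and E :: "nat set set"
    and e :: "nat \<Rightarrow> nat set"
    and w :: "nat \<Rightarrow> real"
  assumes "is_tree {1..n} E"
    and "bij_betw e {1..n - 1} E"
    and "\<forall>s\<in>{1..n - 1}. w s \<noteq> 0"
    and "q \<in> {1..n}"
    and "vdegree E q = 2"
    and "neighbours E q = {p, r}"
    and "i \<in> {1..n - 1}" and "e i = {p, q}"
    and "j \<in> {1..n - 1}" and "e j = {q, r}"
  shows "det (sq_dist_mat n e w) =
    (-1) ^ (n - 1) * 2 ^ (2 * n - 5) * (w i + w j)\<^sup>2 *
    (\<Prod>s = 1..n - 1. (w s)\<^sup>2) * (\<Prod>k\<in>{1..n} - {q}. of_int (tau E k))"
proof -
  have "card E = card {1..n} - 1"
    using bij_betw_same_card[OF assms(2)] by simp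
  then obtain par rk where rt: "rooted_tree {1..n} q par rk" and edges: "rooted_tree.edges {1..n} q par = E"
    using tree_rooted_at[OF assms(1) assms(4)] by blast
  interpret rooted_tree "{1..n}" q par rk by (rule rt)
  interpret numbered_tree n q par rk ..
  let ?S = "{1..n - 1}" and ?V = "{1..n} - {q}"
  let ?f = "\<lambda>z. inv_into ?S e {z, par z}"
  define \<omega> where "\<omega> z = w (?f z)" for z
  have ch: "children q = {p, r}" using neighbours_root edges assms(6) by simp
  have pr: "p \<noteq> r" using assms(5,6) by (auto simp: vdegree_def)
  have p: "p \<in> ?V" "par p = q" and r: "r \<in> ?V" "par r = q"
    using ch unfolding children_def by blast+
  have "inj_on e ?S" using assms(2) by (simp add: bij_betw_def)
  then have \<omega>: "\<omega> p = w i" "\<omega> r = w j"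
    using inv_into_f_f[of e ?S i] inv_into_f_f[of e ?S j] assms(7-10) p(2) r(2)
    by (auto simp: \<omega>_def insert_commute)
  have "sq_dist_mat n e w = vmat n (\<lambda>x y. (tree_dist ?S e w x y)\<^sup>2)"
    by (simp add: sq_dist_mat_def vmat_def)
  also have "\<dots> = vmat n (\<lambda>x y. (rdist \<omega> x y)\<^sup>2)"
  proof (rule vmat_cong)
    fix x y assume "x \<in> {1..n}" "y \<in> {1..n}"
    then obtain xs where "is_path edges x y xs"
      using assms(1) unfolding is_tree_def edges by blast
    moreover have "bij_betw e ?S edges" using assms(2) edges by simp
    ultimately show "(tree_dist ?S e w x y)\<^sup>2 = (rdist \<omega> x y)\<^sup>2"
      by (simp only: tree_dist_eq_rdist \<omega>_def[abs_def])
  qed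
  finally have "det (sq_dist_mat n e w) = 2 * (-4) ^ (n - 3) * (\<omega> p + \<omega> r)\<^sup>2
    * (\<Prod>x\<in>?V. \<omega> x)\<^sup>2 * (\<Prod>v\<in>?V. of_int (tau edges v))"
    by (simp only: det_sq_rdist[OF ch pr])
  \<comment> \<open>Sending a non-root vertex to the index of its parent edge is a bijection onto
    the edge indices.\<close>
  moreover have "(\<Prod>x\<in>?V. \<omega> x) = (\<Prod>s\<in>?S. w s)"
  proof -
    have "bij_betw (\<lambda>z. {z, par z}) ?V E"
      using inj_edge edges by (simp add: bij_betw_def edges_def)
    from bij_betw_trans[OF this bij_betw_inv_into[OF assms(2)]] have "bij_betw ?f ?V ?S"
      by (simp add: comp_def)
    then show ?thesis unfolding \<omega>_def by (rule prod.reindex_bij_betw)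
  qed
  moreover have "2 * (-4) ^ (n - 3) = ((-1) ^ (n - 1) * 2 ^ (2 * n - 5) :: real)"
  proof -
    \<comment> \<open>The three vertices give \<open>3 \<le> n\<close>, so none of the subtractions
      in the exponents is truncated.\<close>
    have "card {p, q, r} \<le> card {1..n}" using p r assms(4) by (intro card_mono) auto
    then have "3 \<le> n" using p r pr by simp
    then obtain m where n: "n = m + 3" using le_Suc_ex[of 3 n] by (auto simp: add.commute)
    have "(-4) ^ m = ((-1) ^ m * 2 ^ (2 * m) :: real)"
      by (simp add: power_mult power_mult_distrib[symmetric])
    moreover have "n - 1 = m + 2" "2 * n - 5 = 2 * m + 1" "n - 3 = m" using n by simp_all
    ultimately show ?thesis by (simp add: power_add)
  qed
  ultimately show ?thesis
    by (simp only: \<omega> edges prod_power_distrib mult_ac)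
qed

end
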